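(* Let $\mathcal{H}$ be a real Hilbert space, $\mathcal{A}:\mathcal{H}\to\mathcal{H}$ a bounded self-adjoint uniformly positive operator, and $b\in\mathcal{H}$. Let $\{u_k\}_k$ be the sequence generated by the Barzilai-Borwein (BB) gradient algorithm for finding the global minimum $u^*$ of $\mathcal{F}(u)=\frac12(\mathcal{A}u,u)-(b,u)$ over $\mathcal{H}$. Then either $u_k=u^*$ for a finite $k$, or the sequence $\{u_k\}_k$ converges $R$-linearly to $u^*$.
   Context: $(\cdot,\cdot)$ and $\|\cdot\|$ are the inner product and norm of $\mathcal{H}$. Let $\delta_{\inf}:=\inf\{(u,\mathcal{A}u):\|u\|=1\}$ and $\delta_{\sup}:=\sup\{(u,\mathcal{A}u):\|u\|=1\}$. Uniformly positive means $\delta_{\inf}>0$; it is assumed throughout that $\delta_{\inf}<\delta_{\sup}$. BB gradient algorithm: let $\mathcal{G}(u)=\mathcal{A}u-b$ be the gradient of $\mathcal{F}$ and $\mathcal{G}_k:=\mathcal{G}(u_k)$. The input is either (C1) two initial iterates $u_0\neq u_1$ in $\mathcal{H}$, or (C2) one initial iterate $u_1\in\mathcal{H}$ and an initial step-size parameter $\alpha_1>0$. For $k=1,2,\dots$: if $\mathcal{G}_k=0$ stop; otherwise (except for $k=1$ under C2, where $\alpha_1$ is given) choose $\alpha_k$ equal to either $$\alpha_k^{BB1}=\frac{(\mathcal{S}_{k-1},\mathcal{Y}_{k-1})}{(\mathcal{S}_{k-1},\mathcal{S}_{k-1})}\quad\text{or}\quad \alpha_k^{BB2}=\frac{(\mathcal{Y}_{k-1},\mathcal{Y}_{k-1})}{(\mathcal{S}_{k-1},\mathcal{Y}_{k-1})},$$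 where $\mathcal{S}_{k-1}=u_k-u_{k-1}$, $\mathcal{Y}_{k-1}=\mathcal{G}_k-\mathcal{G}_{k-1}$ (the choice may be made arbitrarily at each iteration), and set $u_{k+1}=u_k-\frac{1}{\alpha_k}\mathcal{G}_k$. $R$-linear convergence of $u_k$ to $u^*$ means that there are constants $C>0$ and $\theta\in(0,1)$ with $\|u_k-u^*\|\le C\theta^k$ for all $k\ge1$. *)

theory Defs
  imports "HOL-Analysis.Analysis"
begin

definition selfadjoint :: "('a::real_inner \<Rightarrow> 'a) \<Rightarrow> bool" where
  "selfadjoint A \<longleftrightarrow> (\<forall>x y. A x \<bullet> y = x \<bullet> A y)"

text \<open>
  For a bounded operator on a nontrivial space, the two sets of reals below are nonempty and
  bounded, so the real-valued \<open>INF\<close> and \<open>SUP\<close> are the genuine infimum and supremum.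
\<close>

definition delta_inf :: "('a::real_inner \<Rightarrow> 'a) \<Rightarrow> real" where
  "delta_inf A = (INF u\<in>{u. norm u = 1}. u \<bullet> A u)"

definition delta_sup :: "('a::real_inner \<Rightarrow> 'a) \<Rightarrow> real" where
  "delta_sup A = (SUP u\<in>{u. norm u = 1}. u \<bullet> A u)"

definition uniformly_positive :: "('a::real_inner \<Rightarrow> 'a) \<Rightarrow> bool" where
  "uniformly_positive A \<longleftrightarrow> delta_inf A > 0"

definition quad_fun :: "('a::real_inner \<Rightarrow> 'a) \<Rightarrow> 'a \<Rightarrow> 'a \<Rightarrow> real" where
  "quad_fun A b u = 1/2 * (A u \<bullet> u) - b \<bullet> u"

definition quad_grad :: "('a::real_inner \<Rightarrow> 'a) \<Rightarrow> 'a \<Rightarrow> 'a \<Rightarrow> 'a" where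
  "quad_grad A b u = A u - b"

definition BB1 :: "'a::real_inner \<Rightarrow> 'a \<Rightarrow> real" where
  "BB1 s y = (s \<bullet> y) / (s \<bullet> s)"

definition BB2 :: "'a::real_inner \<Rightarrow> 'a \<Rightarrow> real" where
  "BB2 s y = (y \<bullet> y) / (s \<bullet> y)"

definition BB_choice ::
  "('a::real_inner \<Rightarrow> 'a) \<Rightarrow> 'a \<Rightarrow> (nat \<Rightarrow> 'a) \<Rightarrow> (nat \<Rightarrow> real) \<Rightarrow> nat \<Rightarrow> bool" where
  "BB_choice A b u \<alpha> k \<longleftrightarrow>
    (let s = u k - u (k - 1); y = quad_grad A b (u k) - quad_grad A b (u (k - 1))
     in \<alpha> k = BB1 s y \<or> \<alpha> k = BB2 s y)"

text \<open>
  A possibly terminating run is encoded by total sequences: step \<open>k\<close> is executed only if the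
  stopping test has failed at all of \<open>1, \<dots>, k\<close>, and the values after termination
  are unconstrained. The step-size rule applies from index \<open>K\<close> on.
\<close>

definition BB_steps ::
  "nat \<Rightarrow> ('a::real_inner \<Rightarrow> 'a) \<Rightarrow> 'a \<Rightarrow> (nat \<Rightarrow> 'a) \<Rightarrow> (nat \<Rightarrow> real) \<Rightarrow> bool" where
  "BB_steps K A b u \<alpha> \<longleftrightarrow>
    (\<forall>k\<ge>1. (\<forall>j\<in>{1..k}. quad_grad A b (u j) \<noteq> 0) \<longrightarrow>
       (k \<ge> K \<longrightarrow> BB_choice A b u \<alpha> k) \<and>
       u (k + 1) = u k - (1 / \<alpha> k) *\<^sub>R quad_grad A b (u k))"

text \<open>
  The first alternative starts from two distinct iterates; the second from the single iterate
  \<open>u 1\<close> and a given \<open>\<alpha> 1 > 0\<close>, in which case \<open>u 0\<close> is never used.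
\<close>

definition BB_sequence ::
  "('a::real_inner \<Rightarrow> 'a) \<Rightarrow> 'a \<Rightarrow> (nat \<Rightarrow> 'a) \<Rightarrow> (nat \<Rightarrow> real) \<Rightarrow> bool" where
  "BB_sequence A b u \<alpha> \<longleftrightarrow>
    (u 0 \<noteq> u 1 \<and> BB_steps 1 A b u \<alpha>) \<or>
    (\<alpha> 1 > 0 \<and> BB_steps 2 A b u \<alpha>)"

definition R_linear_convergent :: "(nat \<Rightarrow> 'a::real_normed_vector) \<Rightarrow> 'a \<Rightarrow> bool" where
  "R_linear_convergent u l \<longleftrightarrow>
    (\<exists>C>0. \<exists>\<theta>. 0 < \<theta> \<and> \<theta> < 1 \<and> (\<forall>k\<ge>1. norm (u k - l) \<le> C * \<theta> ^ k))"

lemma delta_inf_le: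
  fixes A :: "'a::real_inner \<Rightarrow> 'a"
  assumes "bounded_linear A"
  shows "delta_inf A * (norm v)\<^sup>2 \<le> v \<bullet> A v"
proof (cases "v = 0")
  case False
  interpret bounded_linear A by fact
  obtain M where M: "\<And>x. norm (A x) \<le> norm x * M" using bounded by blast
  have bdd: "bdd_below ((\<lambda>u. u \<bullet> A u) ` {u. norm u = 1})"
  proof (rule bdd_belowI2)
    fix u :: 'a assume "u \<in> {u. norm u = 1}"
    then have "norm u = 1" by simp
    with Cauchy_Schwarz_ineq2[of u "A u"] M[of u] show "- M \<le> u \<bullet> A u" by simp
  qed
  define w where "w = (1 / norm v) *\<^sub>R v"
  have "norm w = 1" using False by (simp add: w_def)
  then have "delta_inf A \<le> w \<bullet> A w"
    unfolding delta_inf_def by (intro cINF_lower[OF bdd]) simp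
  also have "\<dots> = (v \<bullet> A v) / (norm v)\<^sup>2"
    by (simp add: w_def scaleR power2_eq_square)
  finally show ?thesis using False by (simp add: field_simps)
qed (use assms in \<open>simp add: linear_0 bounded_linear.linear\<close>)

lemma GDERIV_quad_fun:
  fixes A :: "'a::real_inner \<Rightarrow> 'a"
  assumes "bounded_linear A" and sa: "selfadjoint A"
  shows "GDERIV (quad_fun A b) u :> quad_grad A b u"
proof -
  have "((\<lambda>u. 1/2 * (A u \<bullet> u) - b \<bullet> u) has_derivative
          (\<lambda>h. 1/2 * (A u \<bullet> h + A h \<bullet> u) - b \<bullet> h)) (at u)"
    by (rule derivative_eq_intros bounded_linear_imp_has_derivative[OF assms(1)] refl)+ auto
  moreover have "1/2 * (A u \<bullet> h + A h \<bullet> u) - b \<bullet> h = h \<bullet> quad_grad A b u" for h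
    using sa[unfolded selfadjoint_def, rule_format, of h u]
    by (simp add: quad_grad_def inner_diff_right inner_commute)
  ultimately show ?thesis
    unfolding gderiv_def quad_fun_def[abs_def] by simp
qed

lemma ex1_minimizer:
  fixes A :: "'a::{real_inner, complete_space} \<Rightarrow> 'a"
  assumes bl: "bounded_linear A" and sa: "selfadjoint A" and up: "uniformly_positive A"
  shows "\<exists>!v. is_arg_min (quad_fun A b) (\<lambda>_. True) v"
proof -
  interpret bounded_linear A by fact
  let ?d = "delta_inf A"
  have d: "?d > 0" using up by (simp add: uniformly_positive_def)
  obtain M0 where M0: "\<And>x. norm (A x) \<le> norm x * M0" using bounded by blast
  define M where "M = max M0 ?d"
  have M: "norm (A x) \<le> M * norm x" for x
  proof -
    have "norm x * M0 \<le> norm x * M" by (intro mult_left_mono) (auto simp: M_def)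
    with M0[of x] show ?thesis by (simp add: mult.commute)
  qed
  have Mpos: "M > 0" "?d \<le> M" using d by (auto simp: M_def)
  define t where "t = ?d / M\<^sup>2"
  define q where "q = 1 - ?d\<^sup>2 / M\<^sup>2"
  have tpos: "t > 0" using d Mpos by (simp add: t_def)
  have "?d\<^sup>2 \<le> M\<^sup>2" using d Mpos by (intro power_mono) auto
  then have q: "0 \<le> q" "q < 1" using d Mpos by (auto simp: q_def field_simps)
  have contr: "norm (x - t *\<^sub>R A x) \<le> sqrt q * norm x" for x
  proof (rule power2_le_imp_le)
    have "(norm (x - t *\<^sub>R A x))\<^sup>2 = (norm x)\<^sup>2 - 2 * t * (x \<bullet> A x) + t\<^sup>2 * (norm (A x))\<^sup>2"
      unfolding power2_norm_eq_inner
      by (simp add: inner_diff_left inner_diff_right inner_commute power2_eq_square algebra_simps)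
    also have "\<dots> \<le> (norm x)\<^sup>2 - 2 * t * (?d * (norm x)\<^sup>2) + t\<^sup>2 * (M * norm x)\<^sup>2"
      using tpos delta_inf_le[OF bl, of x] M[of x]
      by (intro add_mono diff_mono mult_left_mono power_mono) auto
    also have "\<dots> = q * (norm x)\<^sup>2"
      using Mpos by (simp add: t_def q_def field_simps power2_eq_square)
    also have "\<dots> = (sqrt q * norm x)\<^sup>2" using q by (simp add: power_mult_distrib)
    finally show "(norm (x - t *\<^sub>R A x))\<^sup>2 \<le> (sqrt q * norm x)\<^sup>2" .
  qed (use q in simp)
  have "\<exists>!x. x - t *\<^sub>R (A x - b) = x"
  proof (rule banach_fix_type)
    show "0 \<le> sqrt q" "sqrt q < 1" using q by auto
    show "\<forall>x y. dist (x - t *\<^sub>R (A x - b)) (y - t *\<^sub>R (A y - b)) \<le> sqrt q * dist x y"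
      using contr[of "x - y" for x y] by (simp add: dist_norm diff algebra_simps)
  qed
  then obtain v where v: "A v = b" using tpos by auto
  have F: "quad_fun A b x = quad_fun A b v + 1/2 * ((x - v) \<bullet> A (x - v))" for x
    using sa[unfolded selfadjoint_def, rule_format, of x v] v
    by (simp add: quad_fun_def diff inner_diff_left inner_diff_right inner_commute algebra_simps)
  have P: "(x - v) \<bullet> A (x - v) \<ge> ?d * (norm (x - v))\<^sup>2" for x
    using delta_inf_le[OF bl] .
  show ?thesis
  proof (rule ex1I)
    have "quad_fun A b v \<le> quad_fun A b x" for x
    proof -
      have "0 \<le> ?d * (norm (x - v))\<^sup>2" using d by simp
      then show ?thesis using F[of x] P[of x] by linarith
    qed
    then show "is_arg_min (quad_fun A b) (\<lambda>_. True) v"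
      by (simp add: is_arg_min_def not_less)
  next
    fix x assume "is_arg_min (quad_fun A b) (\<lambda>_. True) x"
    then have "quad_fun A b x \<le> quad_fun A b v" by (simp add: is_arg_min_def not_less)
    then have "?d * (norm (x - v))\<^sup>2 \<le> 0" using F[of x] P[of x] by linarith
    then show "x = v" using d by (simp add: mult_le_0_iff)
  qed
qed

end

theory Submission
  imports Defs
begin

text \<open>
  Write \<open>g k\<close> for the gradient at \<open>u k\<close> and \<open>m\<close>, \<open>M\<close> for a lower and an upper bound of \<open>A\<close>.
  The gradients satisfy \<open>g (k+1) = (I - A/\<alpha> k) (g k)\<close>. Components of \<open>g k\<close> in the part of the
  spectrum well below \<open>2 \<alpha> k\<close> are contracted; the others may be amplified, by a bounded factor.
  Since \<open>\<alpha> k\<close> is at least the Rayleigh quotient of \<open>g (k-1)\<close>, those others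
  carry little energy if the low part of the spectrum is given enough weight.

  The weight is \<open>A^(-2p)\<close>. Put \<open>h k = A^(-p) (g k)\<close>; these vectors obey the same recursion, and
  \<open>V k = |h k|^2\<close> satisfies, once \<open>p\<close> is large in terms of \<open>M/m\<close>,
  \<open>V (k+2) \<le> (1 - m/(2M)) V (k+1) + (m/(4M)) V k\<close>.
  As the coefficients add up to less than \<open>1\<close>, \<open>V\<close> decays geometrically.

  The recurrence needs no spectral decomposition, only the log-convexity of the moments
  \<open>a j = (A^j x, x)\<close>, that is, the monotonicity of \<open>a (j+1) / a j\<close>. It is used twice. First, with
  \<open>x = h (k+1)\<close> and \<open>\<alpha> = \<alpha> (k+1)\<close>, either \<open>a 2 / a 1 < 3\<alpha>/2\<close>, and then
  \<open>|x - A x/\<alpha>|^2\<close> is smaller than \<open>|x|^2\<close> by a factor; or all later ratios exceed \<open>3\<alpha>/2\<close> as well,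
  and then \<open>a 2 / \<alpha>^2\<close> is at most \<open>(2/3)^(2p-2)\<close> times \<open>a (2p) / \<alpha>^(2p)\<close>
  (lemma \<open>gradient_step_estimate\<close>). Second, for \<open>x = h k\<close> the Rayleigh quotient of \<open>g k\<close> is
  the ratio \<open>a (2p+1) / a (2p)\<close>, which bounds all earlier ratios and is at most \<open>\<alpha>\<close>, so that
  \<open>a (2p) \<le> \<alpha>^(2p) |h k|^2\<close>. Together these bound the amplified part by an arbitrarily small
  multiple of \<open>V k\<close> (lemma \<open>BB_two_step\<close>). Both BB quotients are at least the Rayleigh quotient,
  so the choice between them does not matter.
\<close>

section \<open>Log-convex sequences and two-step recurrences\<close>

lemma log_convex_ratio_mono:
  fixes a :: "nat \<Rightarrow> real"
  assumes pos: "\<And>j. a j > 0"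
    and lc: "\<And>j. (a (Suc j))\<^sup>2 \<le> a j * a (Suc (Suc j))"
    and "i \<le> j"
  shows "a (Suc i) / a i \<le> a (Suc j) / a j"
proof (rule lift_Suc_mono_le[where f = "\<lambda>j. a (Suc j) / a j", OF _ \<open>i \<le> j\<close>])
  fix n
  show "a (Suc n) / a n \<le> a (Suc (Suc n)) / a (Suc n)"
    using lc[of n] pos[of n] pos[of "Suc n"]
    by (simp add: field_simps power2_eq_square)
qed

lemma log_convex_lower:
  fixes a :: "nat \<Rightarrow> real"
  assumes pos: "\<And>j. a j > 0"
    and lc: "\<And>j. (a (Suc j))\<^sup>2 \<le> a j * a (Suc (Suc j))"
    and c: "0 \<le> c" "c \<le> a (Suc i) / a i" and "i \<le> j"
  shows "c ^ n * a j \<le> a (j + n)"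
proof (induction n)
  case (Suc n)
  have "c \<le> a (Suc (j + n)) / a (j + n)"
    using c(2) log_convex_ratio_mono[of a i "j + n", OF pos lc] \<open>i \<le> j\<close> by simp
  then have "c * a (j + n) \<le> a (Suc (j + n))"
    using pos[of "j + n"] by (simp add: field_simps)
  moreover have "c * (c ^ n * a j) \<le> c * a (j + n)"
    using Suc c(1) by (rule mult_left_mono)
  ultimately show ?case by (simp add: mult.assoc)
qed simp

lemma log_convex_upper:
  fixes a :: "nat \<Rightarrow> real"
  assumes pos: "\<And>j. a j > 0"
    and lc: "\<And>j. (a (Suc j))\<^sup>2 \<le> a j * a (Suc (Suc j))"
    and c: "a (Suc n) / a n \<le> c" and "j \<le> n"
  shows "a j \<le> c ^ j * a 0"
  using \<open>j \<le> n\<close>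
proof (induction j)
  case (Suc j)
  have "0 \<le> c"
    using c pos[of n] pos[of "Suc n"] by (meson divide_pos_pos less_imp_le order_trans)
  have "a (Suc j) / a j \<le> c"
    using c log_convex_ratio_mono[of a j n, OF pos lc] Suc.prems by simp
  then have "a (Suc j) \<le> c * a j"
    using pos[of j] by (simp add: field_simps)
  also have "\<dots> \<le> c * (c ^ j * a 0)"
    using Suc \<open>0 \<le> c\<close> by (intro mult_left_mono) auto
  finally show ?case by (simp add: mult.assoc)
qed simp

lemma two_step_recurrence_decay:
  fixes V :: "nat \<Rightarrow> real"
  assumes rec: "\<And>k. k \<ge> N \<Longrightarrow> V (k + 2) \<le> a * V (k + 1) + c * V k"
    and a: "0 < a" and c: "0 \<le> c" and ac: "a + c < 1"
  shows "\<exists>C>0. \<exists>\<theta>. 0 < \<theta> \<and> \<theta> < 1 \<and> (\<forall>k. V k \<le> C * \<theta> ^ k)"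
proof -
  \<comment> \<open>Because \<open>\<theta> \<le> 1\<close>, this choice gives \<open>a \<theta> + c \<le> \<theta>^2\<close>, so that \<open>\<theta> ^ k\<close> is a
      supersolution of the recurrence.\<close>
  define \<theta> where "\<theta> = sqrt (a + c)"
  have \<theta>: "0 < \<theta>" "\<theta> < 1" "\<theta>\<^sup>2 = a + c" using a c ac by (auto simp: \<theta>_def)
  define C where "C = 1 + (\<Sum>i\<le>N + 1. \<bar>V i\<bar> / \<theta> ^ i)"
  have Cpos: "C > 0" unfolding C_def using \<theta> by (intro add_pos_nonneg sum_nonneg) auto
  have "V k \<le> C * \<theta> ^ k" for k
  proof (induction k rule: less_induct)
    case (less k)
    show ?case
    proof (cases "k \<le> N + 1")
      case True
      have "\<bar>V k\<bar> / \<theta> ^ k \<le> (\<Sum>i\<le>N + 1. \<bar>V i\<bar> / \<theta> ^ i)"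
        using True \<theta> by (intro member_le_sum) auto
      then have "\<bar>V k\<bar> / \<theta> ^ k \<le> C" by (simp add: C_def)
      then show ?thesis using \<theta> by (simp add: field_simps)
    next
      case False
      then obtain j where j: "k = j + 2" "N \<le> j"
        by (intro that[of "k - 2"]) auto
      have "V k \<le> a * V (j + 1) + c * V j" using rec[OF j(2)] j(1) by simp
      also have "\<dots> \<le> a * (C * \<theta> ^ (j + 1)) + c * (C * \<theta> ^ j)"
        using less[of "j + 1"] less[of j] j a c by (intro add_mono mult_left_mono) auto
      also have "\<dots> = (a * \<theta> + c) * (C * \<theta> ^ j)" by (simp add: algebra_simps)
      also have "\<dots> \<le> \<theta>\<^sup>2 * (C * \<theta> ^ j)"
      proof (rule mult_right_mono)
        have "a * \<theta> \<le> a" using a \<theta> by simp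
        then show "a * \<theta> + c \<le> \<theta>\<^sup>2" using \<theta>(3) by simp
      qed (use \<theta> Cpos in simp)
      also have "\<dots> = C * \<theta> ^ k" by (simp add: j power_add power2_eq_square)
      finally show ?thesis .
    qed
  qed
  then show ?thesis using Cpos \<theta> by blast
qed


section \<open>Moments of a coercive self-adjoint operator\<close>

locale coercive_operator =
  fixes A :: "'a::real_inner \<Rightarrow> 'a" and m M :: real
  assumes lin: "linear A"
    and sa: "selfadjoint A"
    and m_pos: "0 < m"
    and coercive: "\<And>x. m * (norm x)\<^sup>2 \<le> x \<bullet> A x"
    and bound: "\<And>x. norm (A x) \<le> M * norm x"
begin

definition moment :: "'a \<Rightarrow> nat \<Rightarrow> real" where
  "moment x j = (A ^^ j) x \<bullet> x"

lemma linear_power: "linear (A ^^ n)"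
proof (induction n)
  case 0
  show ?case using linear_id by (simp add: id_def)
next
  case (Suc n)
  show ?case unfolding funpow.simps by (rule linear_compose[OF Suc lin])
qed

lemma power_commute: "(A ^^ n) (A x) = A ((A ^^ n) x)"
  by (simp add: funpow_swap1)

lemma inner_power: "(A ^^ n) x \<bullet> y = x \<bullet> (A ^^ n) y"
proof (induction n arbitrary: y)
  case (Suc n)
  then show ?case using sa by (simp add: selfadjoint_def power_commute)
qed simp

lemma inner_powers: "(A ^^ i) x \<bullet> (A ^^ j) x = moment x (i + j)"
  by (metis inner_power inner_commute moment_def funpow_add comp_apply add.commute)

lemma moment_power: "moment ((A ^^ n) x) j = moment x (2 * n + j)"
  by (metis inner_powers moment_def funpow_add comp_apply add.commute mult_2 group_cancel.add1)

lemma moment_0: "moment x 0 = (norm x)\<^sup>2"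
  by (simp add: moment_def power2_norm_eq_inner)

lemma norm_power: "(norm ((A ^^ n) x))\<^sup>2 = moment x (2 * n)"
  by (metis moment_power moment_0 add_0_right)

lemma moment_1: "m * (norm x)\<^sup>2 \<le> moment x (Suc 0)"
  using coercive[of x] by (simp add: moment_def inner_commute)

lemma lower_bound: "m * norm x \<le> norm (A x)"
proof (cases "x = 0")
  case False
  have "m * norm x * norm x \<le> norm x * norm (A x)"
    using coercive[of x] norm_cauchy_schwarz[of x "A x"] by (simp add: power2_eq_square)
  then show ?thesis using False by (simp add: mult.commute)
qed simp

lemma inj_A: "inj A"
proof -
  have "x = 0" if "A x = 0" for x
    using lower_bound[of x] that m_pos by (simp add: mult_le_0_iff)
  then show ?thesis using lin by (simp add: linear_injective_0)
qed

lemma inj_power: "inj (A ^^ n)"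
  using inj_A by (rule inj_fn)

lemma power_eq_0_iff: "(A ^^ n) x = 0 \<longleftrightarrow> x = 0"
  using inj_power linear_power by (metis linear_0 injD)

lemma norm_power_le: "norm ((A ^^ n) x) \<le> \<bar>M\<bar> ^ n * norm x"
proof (induction n)
  case (Suc n)
  have "norm ((A ^^ Suc n) x) \<le> M * norm ((A ^^ n) x)" using bound by simp
  also have "\<dots> \<le> \<bar>M\<bar> * norm ((A ^^ n) x)" by (intro mult_right_mono) auto
  also have "\<dots> \<le> \<bar>M\<bar> * (\<bar>M\<bar> ^ n * norm x)" using Suc by (intro mult_left_mono) auto
  finally show ?case by (simp add: mult.assoc)
qed simp

lemma moment_pos:
  assumes "x \<noteq> 0"
  shows "moment x j > 0"
proof (cases "even j")
  case True
  then obtain n where "j = 2 * n" by blast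
  moreover have "(norm ((A ^^ n) x))\<^sup>2 > 0" using assms by (simp add: power_eq_0_iff)
  ultimately show ?thesis by (simp only: norm_power)
next
  case False
  then obtain n where n: "j = 2 * n + Suc 0" by (metis oddE Suc_eq_plus1 add_0)
  have "0 < m * (norm ((A ^^ n) x))\<^sup>2" using assms m_pos by (simp add: power_eq_0_iff)
  also have "\<dots> \<le> moment ((A ^^ n) x) (Suc 0)" by (rule moment_1)
  finally show ?thesis by (simp only: n moment_power)
qed

lemma moment_gradient_step:
  "moment (x - t *\<^sub>R A x) j = moment x j - 2 * t * moment x (Suc j) + t\<^sup>2 * moment x (Suc (Suc j))"
proof -
  interpret P: linear "A ^^ j" by (rule linear_power)
  have "(A ^^ j) x \<bullet> A x = moment x (Suc j)" using inner_powers[of j x 1] by simp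
  moreover have "(A ^^ j) (A x) \<bullet> x = moment x (Suc j)"
    by (simp add: moment_def power_commute)
  moreover have "(A ^^ j) (A x) \<bullet> A x = moment x (Suc (Suc j))"
    using inner_powers[of "Suc j" x 1] by (simp add: power_commute)
  ultimately show ?thesis
    by (simp add: moment_def[of "x - t *\<^sub>R A x"] moment_def[of x j] P.diff P.scaleR
        inner_diff_left inner_diff_right power2_eq_square algebra_simps)
qed

text \<open>
  The quadratic form \<open>moment _ j\<close> is nonnegative on the line \<open>x - t A x\<close>, so the
  discriminant of the quadratic polynomial in \<open>t\<close> is not positive.
\<close>

lemma moment_log_convex:
  assumes "x \<noteq> 0"
  shows "(moment x (Suc j))\<^sup>2 \<le> moment x j * moment x (Suc (Suc j))"
proof -
  define t where "t = moment x (Suc j) / moment x (Suc (Suc j))"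
  have pos: "moment x (Suc (Suc j)) > 0" using assms by (rule moment_pos)
  have "0 \<le> moment (x - t *\<^sub>R A x) j"
  proof (cases "x - t *\<^sub>R A x = 0")
    case True
    then show ?thesis by (simp add: moment_def)
  next
    case False
    then show ?thesis by (intro less_imp_le moment_pos)
  qed
  then have "0 \<le> moment x j - (moment x (Suc j))\<^sup>2 / moment x (Suc (Suc j))"
    using pos unfolding moment_gradient_step by (simp add: t_def power2_eq_square field_simps)
  then show ?thesis using pos by (simp add: field_simps)
qed


section \<open>The BB quotients\<close>

lemma BB1_moment: "BB1 x (A x) = moment x 1 / moment x 0"
  by (simp add: BB1_def moment_def inner_commute)

lemma BB2_moment: "BB2 x (A x) = moment x 2 / moment x 1"
proof -
  have "A x \<bullet> A x = moment x 2" using norm_power[of 1 x] by (simp add: power2_norm_eq_inner)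
  moreover have "x \<bullet> A x = moment x 1" by (simp add: moment_def inner_commute)
  ultimately show ?thesis by (simp add: BB2_def)
qed

lemma BB1_ge:
  assumes "x \<noteq> 0"
  shows "m \<le> BB1 x (A x)"
  using moment_1[of x] assms by (simp add: BB1_moment moment_0 field_simps)

lemma BB1_le_BB2:
  assumes "x \<noteq> 0"
  shows "BB1 x (A x) \<le> BB2 x (A x)"
  using log_convex_ratio_mono[of "moment x" 0 1] moment_pos[OF assms] moment_log_convex[OF assms]
  by (simp add: BB1_moment BB2_moment numeral_2_eq_2)

lemma BB2_le:
  assumes "x \<noteq> 0"
  shows "BB2 x (A x) \<le> M"
proof -
  have "moment x 2 / moment x 1 \<le> moment x 3 / moment x 2"
    using log_convex_ratio_mono[of "moment x" 1 2] moment_pos[OF assms] moment_log_convex[OF assms]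
    by (simp add: numeral_2_eq_2 numeral_3_eq_3)
  also have "\<dots> \<le> M"
  proof -
    have "moment x 3 = moment (A x) 1" using moment_power[of 1 x 1] by simp
    also have "\<dots> = A (A x) \<bullet> A x" by (simp add: moment_def)
    also have "\<dots> \<le> norm (A (A x)) * norm (A x)" by (rule norm_cauchy_schwarz)
    also have "\<dots> \<le> M * norm (A x) * norm (A x)" using bound by (intro mult_right_mono) auto
    also have "\<dots> = M * moment x 2"
      using norm_power[of 1 x] by (simp add: power2_eq_square mult.assoc)
    finally show ?thesis using moment_pos[OF assms, of 2] by (simp add: field_simps)
  qed
  finally show ?thesis by (simp add: BB2_moment)
qed

lemma BB_bounds:
  assumes "x \<noteq> 0" and "\<gamma> = BB1 x (A x) \<or> \<gamma> = BB2 x (A x)"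
  shows "m \<le> \<gamma>" "BB1 x (A x) \<le> \<gamma>" "\<gamma> \<le> M"
  using BB1_ge[OF assms(1)] BB1_le_BB2[OF assms(1)] BB2_le[OF assms(1)] assms(2) by auto

lemma BB1_scaleR:
  assumes "c \<noteq> 0"
  shows "BB1 (c *\<^sub>R x) (A (c *\<^sub>R x)) = BB1 x (A x)"
  using assms by (simp add: BB1_def linear_scale[OF lin])


section \<open>The recurrence for the weighted residuals\<close>

text \<open>
  With \<open>a j\<close> the moments of \<open>x\<close>, the left side is \<open>a 0 - 2 a 1/\<alpha> + a 2/\<alpha>^2\<close>. If
  \<open>a 2 < (3/2) \<alpha> a 1\<close>, the last two terms add up to at most \<open>- a 1/(2\<alpha>)\<close>, and coercivity
  finishes. If \<open>a 2\<close> is larger, then the moments grow at least like \<open>(3\<alpha>/2)^j\<close> from there on,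
  and \<open>a 2/\<alpha>^2\<close> is absorbed by the high moment.
\<close>

lemma gradient_step_estimate:
  assumes \<alpha>: "0 < \<alpha>" and e: "1 \<le> e * (3/2) ^ (2 * r)"
  shows "(norm (x - (1/\<alpha>) *\<^sub>R A x))\<^sup>2
    \<le> (1 - m / (2 * \<alpha>)) * (norm x)\<^sup>2 + e * (norm ((A ^^ Suc r) x))\<^sup>2 / \<alpha> ^ (2 * Suc r)"
proof (cases "x = 0")
  case True
  then show ?thesis using power_eq_0_iff[of "Suc r" 0] linear_0[OF lin] by simp
next
  case False
  define a where "a = moment x"
  note pos = moment_pos[OF False, folded a_def]
  note lc = moment_log_convex[OF False, folded a_def]
  have e_pos: "0 < e"
  proof (rule ccontr)
    assume "\<not> 0 < e"
    then have "e * (3/2) ^ (2 * r) \<le> 0" by (intro mult_nonpos_nonneg) auto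
    with e show False by simp
  qed
  have lhs: "(norm (x - (1/\<alpha>) *\<^sub>R A x))\<^sup>2 = a 0 - 2 * (a 1 / \<alpha>) + a 2 / \<alpha>\<^sup>2"
    using moment_gradient_step[of x "1/\<alpha>" 0]
    by (simp add: moment_0 a_def power_divide flip: numeral_2_eq_2)
  have "m * a 0 \<le> a 1" using moment_1[of x] by (simp add: moment_0 a_def)
  define q where "q = m / \<alpha> * a 0"
  have a1: "q \<le> a 1 / \<alpha>" using \<open>m * a 0 \<le> a 1\<close> \<alpha> by (simp add: q_def field_simps)
  have q_nonneg: "0 \<le> q" using m_pos \<alpha> pos[of 0] by (simp add: q_def)
  have q_eq: "(1 - m / (2 * \<alpha>)) * a 0 = a 0 - q / 2" by (simp add: q_def field_simps)
  have high: "(norm ((A ^^ Suc r) x))\<^sup>2 = a (2 + 2 * r)"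
    by (simp only: norm_power a_def) simp
  have "a 0 - 2 * (a 1 / \<alpha>) + a 2 / \<alpha>\<^sup>2
      \<le> (1 - m / (2 * \<alpha>)) * a 0 + e * a (2 + 2 * r) / \<alpha> ^ (2 * Suc r)"
  proof (cases "3/2 * \<alpha> \<le> a (Suc 1) / a 1")
    case True
    have "(3/2 * \<alpha>) ^ (2 * r) * a 2 \<le> a (2 + 2 * r)"
      using log_convex_lower[of a, OF pos lc _ True, of 2 "2 * r"] \<alpha> by simp
    then have "e * ((3/2 * \<alpha>) ^ (2 * r) * a 2) \<le> e * a (2 + 2 * r)"
      using e_pos by simp
    moreover have "1 * (\<alpha> ^ (2 * r) * a 2) \<le> e * (3/2) ^ (2 * r) * (\<alpha> ^ (2 * r) * a 2)"
      using e \<alpha> pos[of 2] by (intro mult_right_mono) auto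
    moreover have "e * (3/2) ^ (2 * r) * (\<alpha> ^ (2 * r) * a 2) = e * ((3/2 * \<alpha>) ^ (2 * r) * a 2)"
      by (simp only: power_mult_distrib mult_ac)
    ultimately have "\<alpha> ^ (2 * r) * a 2 \<le> e * a (2 + 2 * r)"
      by linarith
    then have "\<alpha> ^ (2 * r) * a 2 / \<alpha> ^ (2 * Suc r) \<le> e * a (2 + 2 * r) / \<alpha> ^ (2 * Suc r)"
      using \<alpha> by (intro divide_right_mono) auto
    moreover have "\<alpha> ^ (2 * r) * a 2 / \<alpha> ^ (2 * Suc r) = a 2 / \<alpha>\<^sup>2"
      using \<alpha> by (simp add: power2_eq_square)
    ultimately have "a 2 / \<alpha>\<^sup>2 \<le> e * a (2 + 2 * r) / \<alpha> ^ (2 * Suc r)" by metis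
    then show ?thesis using a1 q_nonneg unfolding q_eq by linarith
  next
    case False
    then have "a 2 \<le> 3/2 * \<alpha> * a 1"
      using pos[of 1] by (simp add: field_simps numeral_2_eq_2)
    then have "a 2 / \<alpha>\<^sup>2 \<le> 3/2 * (a 1 / \<alpha>)"
      using \<alpha> by (simp add: field_simps power2_eq_square)
    moreover have "0 \<le> e * a (2 + 2 * r) / \<alpha> ^ (2 * Suc r)"
      using e_pos \<alpha> pos[of "2 + 2 * r"] by simp
    ultimately show ?thesis using a1 q_nonneg unfolding q_eq by linarith
  qed
  then show ?thesis
    unfolding lhs high by (simp add: a_def moment_0)
qed

text \<open>
  The Rayleigh quotient of \<open>A^p x\<close> is the ratio of the moments of order \<open>2p+1\<close> and \<open>2p\<close>
  of \<open>x\<close>, which dominates all earlier ratios.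
\<close>

lemma norm_power_le_Rayleigh:
  assumes x: "x \<noteq> 0" and \<alpha>: "BB1 ((A ^^ p) x) (A ((A ^^ p) x)) \<le> \<alpha>"
  shows "(norm ((A ^^ p) x))\<^sup>2 \<le> \<alpha> ^ (2 * p) * (norm x)\<^sup>2"
proof -
  have "moment x (Suc (2 * p)) / moment x (2 * p) \<le> \<alpha>"
    using \<alpha> by (simp add: BB1_moment moment_power)
  from log_convex_upper[of "moment x", OF moment_pos[OF x] moment_log_convex[OF x] this order_refl]
  show ?thesis by (simp add: norm_power moment_0)
qed

lemma norm_gradient_step_le:
  assumes "m \<le> \<beta>"
  shows "norm (x - (1/\<beta>) *\<^sub>R A x) \<le> (1 + M / m) * norm x"
proof -
  have "norm (x - (1/\<beta>) *\<^sub>R A x) \<le> norm x + norm (A x) / \<beta>"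
    using norm_triangle_ineq4[of x "(1/\<beta>) *\<^sub>R A x"] assms m_pos by simp
  also have "norm (A x) / \<beta> \<le> norm (A x) / m"
    using assms m_pos by (intro divide_left_mono) auto
  also have "\<dots> \<le> M * norm x / m"
    using bound m_pos by (intro divide_right_mono) auto
  finally show ?thesis by (simp add: algebra_simps)
qed

text \<open>
  Here \<open>\<beta>\<close> and \<open>\<alpha>\<close> are consecutive step parameters and \<open>\<alpha>\<close> is at least the Rayleigh quotient of
  the gradient \<open>A^(r+1) x\<close> at which the step with \<open>\<beta>\<close> was taken. In the estimate for the second
  step, the high-order term is evaluated at \<open>x - A x/\<beta>\<close>. As powers of \<open>A\<close> commute with the
  first step, it is at most a bounded multiple of the same term at \<open>x\<close>, where the delayed
  Rayleigh quotient controls it.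
\<close>

lemma BB_two_step:
  fixes x :: 'a
  defines "K \<equiv> (1 + M / m)\<^sup>2"
  assumes x: "x \<noteq> 0" and \<beta>: "m \<le> \<beta>" and \<alpha>: "\<alpha> \<le> M"
    and Rayleigh: "BB1 ((A ^^ Suc r) x) (A ((A ^^ Suc r) x)) \<le> \<alpha>"
    and e: "1 \<le> e * (3/2) ^ (2 * r)" "0 \<le> e"
    and y: "y = x - (1/\<beta>) *\<^sub>R A x" and z: "z = y - (1/\<alpha>) *\<^sub>R A y"
  shows "(norm z)\<^sup>2 \<le> (1 - m / (2 * M)) * (norm y)\<^sup>2 + e * K * (norm x)\<^sup>2"
proof -
  let ?p = "Suc r"
  have "(A ^^ ?p) x \<noteq> 0" using x by (simp only: power_eq_0_iff) simp
  then have "m \<le> \<alpha>" using BB1_ge Rayleigh by (meson order_trans)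
  then have \<alpha>_pos: "0 < \<alpha>" using m_pos by simp
  interpret P: linear "A ^^ ?p" by (rule linear_power)
  have "(A ^^ ?p) y = (A ^^ ?p) x - (1/\<beta>) *\<^sub>R A ((A ^^ ?p) x)"
    by (simp only: y P.diff P.scaleR power_commute)
  then have "norm ((A ^^ ?p) y) \<le> (1 + M / m) * norm ((A ^^ ?p) x)"
    using norm_gradient_step_le[OF \<beta>] by metis
  then have "(norm ((A ^^ ?p) y))\<^sup>2 \<le> K * (norm ((A ^^ ?p) x))\<^sup>2"
    unfolding K_def power_mult_distrib[symmetric] by (rule power_mono) simp
  also have "\<dots> \<le> K * (\<alpha> ^ (2 * ?p) * (norm x)\<^sup>2)"
    by (rule mult_left_mono[OF norm_power_le_Rayleigh[OF x Rayleigh]]) (simp add: K_def)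
  finally have "(norm ((A ^^ ?p) y))\<^sup>2 / \<alpha> ^ (2 * ?p) \<le> K * (norm x)\<^sup>2"
    using \<alpha>_pos by (simp only: pos_divide_le_eq zero_less_power) (simp only: mult_ac)
  then have high: "e * (norm ((A ^^ ?p) y))\<^sup>2 / \<alpha> ^ (2 * ?p) \<le> e * K * (norm x)\<^sup>2"
    using mult_left_mono[OF _ e(2)] by (simp only: times_divide_eq_right[symmetric] mult.assoc)
  have "m / (2 * M) \<le> m / (2 * \<alpha>)"
    using \<alpha> \<alpha>_pos m_pos by (intro divide_left_mono) auto
  then have "(1 - m / (2 * \<alpha>)) * (norm y)\<^sup>2 \<le> (1 - m / (2 * M)) * (norm y)\<^sup>2"
    by (intro mult_right_mono) auto
  with high gradient_step_estimate[OF \<alpha>_pos e(1), of y] show ?thesis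
    unfolding z by linarith
qed

text \<open>
  The first index \<open>2\<close> is where both bounds on the step parameter become available: \<open>\<alpha> 1\<close> may be
  an arbitrary input, or be computed from a difference \<open>u 1 - u 0\<close> unrelated to a gradient.
\<close>

lemma BB_residual_decay:
  fixes g :: "nat \<Rightarrow> 'a"
  assumes surj: "surj A"
    and step: "\<And>k. k \<ge> 2 \<Longrightarrow> g (k + 1) = g k - (1 / \<alpha> k) *\<^sub>R A (g k)"
    and nz: "\<And>k. k \<ge> 2 \<Longrightarrow> g k \<noteq> 0"
    and \<alpha>: "\<And>k. k \<ge> 2 \<Longrightarrow> m \<le> \<alpha> k \<and> \<alpha> k \<le> M"
    and Rayleigh: "\<And>k. k \<ge> 2 \<Longrightarrow> BB1 (g k) (A (g k)) \<le> \<alpha> (k + 1)"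
  shows "\<exists>C>0. \<exists>\<theta>. 0 < \<theta> \<and> \<theta> < 1 \<and> (\<forall>k. norm (g k) \<le> C * \<theta> ^ k)"
proof -
  have mM: "m \<le> M" using \<alpha>[of 2] by simp
  define K where "K = (1 + M / m)\<^sup>2"
  have K_pos: "K > 0" using m_pos mM unfolding K_def by (intro zero_less_power add_pos_pos) auto
  define e where "e = m / (4 * M) / K"
  have e_pos: "e > 0" using m_pos mM K_pos by (simp add: e_def)
  obtain r :: nat where "1 / e < (9/4) ^ r"
    using real_arch_pow[of "9/4" "1 / e"] by auto
  moreover have "(9/4 :: real) ^ r = (3/2) ^ (2 * r)"
    by (simp add: power_mult power2_eq_square)
  ultimately have "1 / e < (3/2) ^ (2 * r)" by simp
  then have e: "1 \<le> e * (3/2) ^ (2 * r)"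
    using e_pos by (simp only: pos_divide_less_eq) (simp only: mult.commute less_imp_le)
  let ?P = "A ^^ Suc r"
  interpret P: linear ?P by (rule linear_power)
  have surjP: "surj ?P" using surj by (rule surj_fn)
  define h where "h k = inv ?P (g k)" for k
  have h: "?P (h k) = g k" for k unfolding h_def using surjP by (rule surj_f_inv_f)
  have h_step: "h (k + 1) = h k - (1 / \<alpha> k) *\<^sub>R A (h k)" if "k \<ge> 2" for k
  proof (rule injD[OF inj_power[of "Suc r"]])
    show "?P (h (k + 1)) = ?P (h k - (1 / \<alpha> k) *\<^sub>R A (h k))"
      using step[OF that] by (simp only: P.diff P.scaleR power_commute h)
  qed
  have rec: "(norm (h (k + 2)))\<^sup>2
      \<le> (1 - m / (2 * M)) * (norm (h (k + 1)))\<^sup>2 + m / (4 * M) * (norm (h k))\<^sup>2"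
    if k: "k \<ge> 2" for k
  proof -
    have "h k \<noteq> 0" using nz[OF k] h[of k] P.zero by metis
    moreover have "h (k + 2) = h (k + 1) - (1 / \<alpha> (k + 1)) *\<^sub>R A (h (k + 1))"
      using h_step[of "k + 1"] k by simp
    moreover have "BB1 (?P (h k)) (A (?P (h k))) \<le> \<alpha> (k + 1)"
      using Rayleigh[OF k] by (simp only: h)
    ultimately have "(norm (h (k + 2)))\<^sup>2
        \<le> (1 - m / (2 * M)) * (norm (h (k + 1)))\<^sup>2 + e * K * (norm (h k))\<^sup>2"
      unfolding K_def using \<alpha>[of k] \<alpha>[of "k + 1"] k e e_pos h_step[OF k]
      by (intro BB_two_step[of "h k" "\<alpha> k" "\<alpha> (k + 1)" r e]) auto
    then show ?thesis using K_pos by (simp add: e_def)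
  qed
  have q: "0 < m / (4 * M)" "m / (2 * M) = 2 * (m / (4 * M))" "m / (4 * M) \<le> 1 / 4"
    using m_pos mM by (auto simp: field_simps)
  have "\<exists>C>0. \<exists>\<theta>. 0 < \<theta> \<and> \<theta> < 1 \<and> (\<forall>k. (norm (h k))\<^sup>2 \<le> C * \<theta> ^ k)"
    by (rule two_step_recurrence_decay[where N = 2, OF rec]) (use q in linarith)+
  then obtain C \<theta> where C: "C > 0" and \<theta>: "0 < \<theta>" "\<theta> < 1"
    and hC: "\<And>k. (norm (h k))\<^sup>2 \<le> C * \<theta> ^ k" by blast
  have "norm (g k) \<le> (M ^ Suc r * sqrt C) * sqrt \<theta> ^ k" for k
  proof -
    have "norm (g k) \<le> M ^ Suc r * norm (h k)"
      using norm_power_le[of "Suc r" "h k"] mM m_pos unfolding h by simp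
    also have "norm (h k) \<le> sqrt (C * \<theta> ^ k)" using hC by (rule real_le_rsqrt)
    also have "sqrt (C * \<theta> ^ k) = sqrt C * sqrt \<theta> ^ k"
      by (simp add: real_sqrt_mult real_sqrt_power)
    finally show ?thesis using mM m_pos by (simp add: mult.assoc mult_left_mono)
  qed
  moreover have "M ^ Suc r * sqrt C > 0" "0 < sqrt \<theta>" "sqrt \<theta> < 1"
    using C \<theta> mM m_pos by auto
  ultimately show ?thesis by blast
qed

end


section \<open>Convergence of the BB algorithm\<close>

lemma quad_grad_minimizer:
  fixes A :: "'a::real_inner \<Rightarrow> 'a"
  assumes "bounded_linear A" "selfadjoint A"
    and "is_arg_min (quad_fun A b) (\<lambda>_. True) v"
  shows "quad_grad A b v = 0"
proof -
  have "(\<lambda>h. h \<bullet> quad_grad A b v) = (\<lambda>h. 0)"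
  proof (rule differential_zero_maxmin)
    show "(quad_fun A b has_derivative (\<lambda>h. h \<bullet> quad_grad A b v)) (at v)"
      using GDERIV_quad_fun[OF assms(1,2)] by (simp add: gderiv_def)
    show "(\<forall>y\<in>UNIV. quad_fun A b y \<le> quad_fun A b v) \<or> (\<forall>y\<in>UNIV. quad_fun A b v \<le> quad_fun A b y)"
      using assms(3) by (auto simp: is_arg_min_def not_less)
  qed auto
  then show ?thesis by (metis inner_eq_zero_iff)
qed

theorem theorem2:
  fixes A :: "'a::{real_inner, complete_space} \<Rightarrow> 'a"
    and b ustar :: 'a
    and u :: "nat \<Rightarrow> 'a"
    and \<alpha> :: "nat \<Rightarrow> real"
  assumes "bounded_linear A"
    and "selfadjoint A"
    and "uniformly_positive A"
    and "delta_inf A < delta_sup A"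
    and "is_arg_min (quad_fun A b) (\<lambda>_. True) ustar"
    and "BB_sequence A b u \<alpha>"
  shows "(\<exists>k\<ge>1. u k = ustar) \<or> R_linear_convergent u ustar"
proof (cases "\<exists>k\<ge>1. u k = ustar")
  case False
  then have ne: "u k \<noteq> ustar" if "k \<ge> 1" for k using that by blast
  interpret A: bounded_linear A by fact
  obtain M where M: "\<And>x. norm (A x) \<le> M * norm x"
    using A.bounded by (metis mult.commute)
  define m where "m = delta_inf A"
  interpret coercive_operator A m M
    using assms(2,3) delta_inf_le[OF assms(1)] M A.linear_axioms
    by unfold_locales (auto simp: m_def uniformly_positive_def)
  \<comment> \<open>The minimizer of \<open>quad_fun A c\<close> is a preimage of \<open>c\<close>.\<close>
  have "\<exists>v. A v = c" for c
    using ex1_minimizer[OF assms(1-3), of c] quad_grad_minimizer[OF assms(1,2), of c]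
    by (auto simp: quad_grad_def)
  then have surj: "surj A" by (metis surjI)
  define g where "g k = quad_grad A b (u k)" for k
  have "A ustar = b"
    using quad_grad_minimizer[OF assms(1,2,5)] by (simp add: quad_grad_def)
  then have g_eq: "g k = A (u k - ustar)" for k
    by (simp add: g_def quad_grad_def A.diff)
  have g_nz: "g k \<noteq> 0" if "k \<ge> 1" for k
    unfolding g_eq using power_eq_0_iff[of 1 "u k - ustar"] ne[OF that] by simp
  have g_diff: "g i - g j = A (u i - u j)" for i j
    by (simp add: g_def quad_grad_def A.diff)
  have choice: "\<alpha> k = BB1 (u k - u (k - 1)) (A (u k - u (k - 1))) \<or>
      \<alpha> k = BB2 (u k - u (k - 1)) (A (u k - u (k - 1)))" if "BB_choice A b u \<alpha> k" for k
    using that unfolding BB_choice_def Let_def g_def[symmetric] g_diff .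
  have running: "(k \<ge> K \<longrightarrow> BB_choice A b u \<alpha> k) \<and> u (k + 1) = u k - (1 / \<alpha> k) *\<^sub>R g k"
    if "BB_steps K A b u \<alpha>" "k \<ge> 1" for K k
    using that g_nz unfolding BB_steps_def g_def by auto
  have u_step: "u (k + 1) = u k - (1 / \<alpha> k) *\<^sub>R g k" if "k \<ge> 1" for k
    using assms(6) running that unfolding BB_sequence_def by blast
  have rule2: "BB_choice A b u \<alpha> k" if "k \<ge> 2" for k
    using assms(6) running[of _ k] that unfolding BB_sequence_def by fastforce
  have \<alpha>1: "\<alpha> 1 > 0"
    using assms(6) unfolding BB_sequence_def
  proof
    assume *: "u 0 \<noteq> u 1 \<and> BB_steps 1 A b u \<alpha>"
    then have "BB_choice A b u \<alpha> 1" using running[of 1 1] by simp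
    then have "m \<le> \<alpha> 1" using choice[of 1] * by (intro BB_bounds(1)[of "u 1 - u 0"]) auto
    then show ?thesis using m_pos by simp
  qed simp
  \<comment> \<open>From index \<open>2\<close> on, the difference in the BB quotients is a multiple of the previous
      gradient, nonzero as soon as the previous step parameter is.\<close>
  have \<alpha>_Suc: "m \<le> \<alpha> (k + 1) \<and> \<alpha> (k + 1) \<le> M \<and> BB1 (g k) (A (g k)) \<le> \<alpha> (k + 1)"
    if k: "k \<ge> 1" and pos: "\<alpha> k > 0" for k
  proof -
    define s where "s = u (k + 1) - u k"
    have s: "s = (- (1 / \<alpha> k)) *\<^sub>R g k" using u_step[OF k] by (simp add: s_def)
    then have "s \<noteq> 0" using g_nz[OF k] pos by simp
    moreover have "\<alpha> (k + 1) = BB1 s (A s) \<or> \<alpha> (k + 1) = BB2 s (A s)"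
      using choice[OF rule2, of "k + 1"] k by (simp add: s_def)
    moreover have "BB1 s (A s) = BB1 (g k) (A (g k))"
      unfolding s using pos by (intro BB1_scaleR) simp
    ultimately show ?thesis using BB_bounds[of s "\<alpha> (k + 1)"] by simp
  qed
  have \<alpha>_pos: "\<alpha> k > 0" if "k \<ge> 1" for k
    using that
  proof (induction k rule: dec_induct)
    case (step k)
    then show ?case using \<alpha>_Suc[of k] m_pos by simp
  qed (rule \<alpha>1)
  have "\<exists>C>0. \<exists>\<theta>. 0 < \<theta> \<and> \<theta> < 1 \<and> (\<forall>k. norm (g k) \<le> C * \<theta> ^ k)"
  proof (rule BB_residual_decay[OF surj])
    fix k :: nat assume k: "k \<ge> 2"
    show "g (k + 1) = g k - (1 / \<alpha> k) *\<^sub>R A (g k)"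
      using u_step[of k] k by (simp add: g_def quad_grad_def A.diff A.scaleR)
    show "g k \<noteq> 0" using g_nz k by simp
    show "m \<le> \<alpha> k \<and> \<alpha> k \<le> M"
      using \<alpha>_Suc[of "k - 1"] \<alpha>_pos[of "k - 1"] k by simp
    show "BB1 (g k) (A (g k)) \<le> \<alpha> (k + 1)"
      using \<alpha>_Suc[of k] \<alpha>_pos[of k] k by simp
  qed
  then obtain C \<theta> where C: "C > 0" and \<theta>: "0 < \<theta>" "\<theta> < 1"
    and gC: "\<And>k. norm (g k) \<le> C * \<theta> ^ k" by blast
  have "norm (u k - ustar) \<le> C / m * \<theta> ^ k" for k
  proof -
    have "m * norm (u k - ustar) \<le> C * \<theta> ^ k"
      using lower_bound[of "u k - ustar"] gC[of k] by (simp add: g_eq)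
    then show ?thesis using m_pos by (simp add: field_simps)
  qed
  moreover have "C / m > 0" using C m_pos by simp
  ultimately have "R_linear_convergent u ustar"
    unfolding R_linear_convergent_def using \<theta> by blast
  then show ?thesis ..
qed simp

end
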